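(* Let $T\in G$ be an elliptic isometry having $M$ as its time-like eigenspace. Then $$Z(T)=G_M\times Z(T|_{M^{\dagger}}),$$ where $Z(T|_{M^{\dagger}})\subseteq\mathcal{U}(M^{\dagger})$.
   Context: $H$ is a complex Hilbert space with inner product $\langle\cdot,\cdot\rangle$ (linear in the first variable), $B$ its open unit ball. $\mathcal{A}((x,z),(y,w))=\langle x,y\rangle-z\overline{w}$ is a Hermitian form on $H\oplus\mathbb{C}$. $G$ is the group of all bijective bounded linear operators on $H\oplus\mathbb{C}$ preserving $\mathcal{A}$; its elements are called isometries. Each $T\in G$ acts on $\overline{B}$ by $\widetilde{T}(x)=y/w$ where $T(x,1)=(y,w)$; $T$ is elliptic if $\widetilde{T}$ has a fixed point in $B$. A vector $v$ is time-like if $\mathcal{A}(v,v)<0$; the time-like eigenspace of an elliptic $T$ is the eigenspace of $T$ that contains a time-like vector (there is exactly one). For a subspace $M$, $M^{\dagger}=\{v:\mathcal{A}(v,m)=0\ \forall m\in M\}$. For a closed subspace $N\subseteq H\oplus\mathbb{C}$, $G_N$ is the group of all bijective bounded linear maps of $N$ preserving $\mathcal{A}|_N$. $Z(T)$ is the centralizer of $T$ in $G$, and $Z(T|_{M^{\dagger}})$ is the centralizer of $T|_{M^\dagger}$ in $G_{M^\dagger}$. $\mathcal{U}(M^{\dagger})$ is the unitary group of $M^{\dagger}$, regarded as a Hilbert space with inner product $\mathcal{A}|_{M^{\dagger}}$ (that this form is positive definite and complete on $M^\dagger$ is part of the assertion). The product means: $H\oplus\mathbb{C}=M\oplus M^{\dagger}$,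 and $Z(T)$ consists exactly of the operators $S_1\oplus S_2$ with $S_1\in G_M$ and $S_2\in Z(T|_{M^{\dagger}})$. *)

theory Defs
  imports "HOL-Analysis.Analysis" "HOL-Algebra.Algebra"
begin

text \<open>Complex Hilbert spaces. The inner product is linear in the first variable.\<close>

class scaleC =
  fixes scaleC :: "complex \<Rightarrow> 'a \<Rightarrow> 'a" (infixr "*\<^sub>C" 75)

class complex_vector = scaleC + real_vector +
  assumes scaleC_add_right: "a *\<^sub>C (x + y) = a *\<^sub>C x + a *\<^sub>C y"
    and scaleC_add_left: "(a + b) *\<^sub>C x = a *\<^sub>C x + b *\<^sub>C x"
    and scaleC_scaleC: "a *\<^sub>C b *\<^sub>C x = (a * b) *\<^sub>C x"
    and scaleC_one: "1 *\<^sub>C x = x"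
    and scaleR_scaleC: "r *\<^sub>R x = complex_of_real r *\<^sub>C x"

class complex_inner = complex_vector + real_normed_vector +
  fixes cinner :: "'a \<Rightarrow> 'a \<Rightarrow> complex"
  assumes cinner_commute: "cinner x y = cnj (cinner y x)"
    and cinner_add_left: "cinner (x + y) z = cinner x z + cinner y z"
    and cinner_scaleC_left: "cinner (a *\<^sub>C x) y = a * cinner x y"
    and cinner_ge_zero: "0 \<le> Re (cinner x x)"
    and cinner_eq_zero_iff: "cinner x x = 0 \<longleftrightarrow> x = 0"
    and norm_eq_sqrt_cinner: "norm x = sqrt (Re (cinner x x))"

class chilbert_space = complex_inner + complete_space

global_interpretation cvs: vector_space "scaleC :: complex \<Rightarrow> 'a \<Rightarrow> 'a::complex_vector"
  by unfold_locales (rule scaleC_add_right scaleC_add_left scaleC_scaleC scaleC_one)+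

instantiation complex :: chilbert_space
begin

definition scaleC_complex_def: "a *\<^sub>C (x::complex) = a * x"

definition cinner_complex_def: "cinner (x::complex) y = x * cnj y"

instance
  by standard
    (auto simp: scaleC_complex_def cinner_complex_def algebra_simps scaleR_conv_of_real
      complex_norm cmod_def power2_eq_square)

end

text \<open>The Hilbert direct sum; in particular \<open>'h \<times> complex\<close> carries the norm
  \<open>sqrt (\<parallel>x\<parallel>\<^sup>2 + \<bar>z\<bar>\<^sup>2)\<close>.\<close>

instantiation prod :: (complex_vector, complex_vector) complex_vector
begin

definition scaleC_prod_def: "a *\<^sub>C p = (a *\<^sub>C fst p, a *\<^sub>C snd p)"

instance
  by standard
    (auto simp: scaleC_prod_def scaleC_add_right scaleC_add_left scaleC_scaleC scaleC_one
      scaleR_scaleC prod_eq_iff)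

end

instantiation prod :: (chilbert_space, chilbert_space) chilbert_space
begin

definition cinner_prod_def: "cinner p q = cinner (fst p) (fst q) + cinner (snd p) (snd q)"

instance
proof
  fix p q r :: "'a \<times> 'b" and a :: complex
  show "cinner p q = cnj (cinner q p)"
    unfolding cinner_prod_def complex_cnj_add by (metis cinner_commute)
  show "cinner (p + q) r = cinner p r + cinner q r"
    by (simp add: cinner_prod_def cinner_add_left)
  show "cinner (a *\<^sub>C p) q = a * cinner p q"
    by (simp add: cinner_prod_def scaleC_prod_def cinner_scaleC_left distrib_left)
  show "0 \<le> Re (cinner p p)"
    by (simp add: cinner_prod_def cinner_ge_zero)
  show n: "norm p = sqrt (Re (cinner p p))"
    by (simp add: cinner_prod_def norm_prod_def norm_eq_sqrt_cinner cinner_ge_zero)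
  show "cinner p p = 0 \<longleftrightarrow> p = 0"
  proof
    assume "cinner p p = 0"
    then show "p = 0" using n by simp
  next
    assume "p = 0"
    then show "cinner p p = 0"
      using cinner_eq_zero_iff[of "0::'a"] cinner_eq_zero_iff[of "0::'b"]
      by (simp add: cinner_prod_def)
  qed
qed

end

definition hform :: "'h::chilbert_space \<times> complex \<Rightarrow> 'h \<times> complex \<Rightarrow> complex" where
  "hform p q = cinner (fst p) (fst q) - snd p * cnj (snd q)"

definition timelike :: "'h::chilbert_space \<times> complex \<Rightarrow> bool" where
  "timelike v \<longleftrightarrow> Re (hform v v) < 0"  \<comment> \<open>\<open>hform v v\<close> is always real\<close>

definition dagger :: "('h::chilbert_space \<times> complex) set \<Rightarrow> ('h \<times> complex) set" where
  "dagger M = {v. \<forall>m\<in>M. hform v m = 0}"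

definition clinear_on :: "'v::complex_vector set \<Rightarrow> ('v \<Rightarrow> 'v) \<Rightarrow> bool" where
  "clinear_on N f \<longleftrightarrow> (\<forall>x\<in>N. \<forall>y\<in>N. f (x + y) = f x + f y) \<and> (\<forall>a. \<forall>x\<in>N. f (a *\<^sub>C x) = a *\<^sub>C f x)"

definition bounded_on :: "'v::real_normed_vector set \<Rightarrow> ('v \<Rightarrow> 'v) \<Rightarrow> bool" where
  "bounded_on N f \<longleftrightarrow> (\<exists>K. \<forall>x\<in>N. norm (f x) \<le> norm x * K)"

definition preserves_on :: "'v set \<Rightarrow> ('v \<Rightarrow> 'v \<Rightarrow> complex) \<Rightarrow> ('v \<Rightarrow> 'v) \<Rightarrow> bool" where
  "preserves_on N A f \<longleftrightarrow> (\<forall>x\<in>N. \<forall>y\<in>N. A (f x) (f y) = A x y)"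

text \<open>Operators on a subspace \<open>N\<close> are represented, as in the theory \<open>Bij\<close> of HOL-Algebra,
  by functions that are \<open>undefined\<close> outside \<open>N\<close>. For \<open>N = UNIV\<close> the group
  below consists of ordinary functions composed by \<open>\<circ>\<close>, and it is the group \<open>G\<close> of all
  isometries of \<open>H \<oplus> \<complex>\<close>.\<close>

definition isom_group :: "('h::chilbert_space \<times> complex) set \<Rightarrow> ('h \<times> complex \<Rightarrow> 'h \<times> complex) monoid" where
  "isom_group N =
    \<lparr>carrier = {f \<in> extensional N. bij_betw f N N \<and> clinear_on N f \<and> bounded_on N f \<and>
                  preserves_on N hform f},
     monoid.mult = compose N,
     one = (\<lambda>x\<in>N. x)\<rparr>"

definition centralizer :: "('a, 'b) monoid_scheme \<Rightarrow> 'a \<Rightarrow> 'a set" where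
  "centralizer G x = {g \<in> carrier G. g \<otimes>\<^bsub>G\<^esub> x = x \<otimes>\<^bsub>G\<^esub> g}"

definition ball_action :: "('h::chilbert_space \<times> complex \<Rightarrow> 'h \<times> complex) \<Rightarrow> 'h \<Rightarrow> 'h" where
  "ball_action T x = inverse (snd (T (x, 1))) *\<^sub>C fst (T (x, 1))"

definition elliptic :: "('h::chilbert_space \<times> complex \<Rightarrow> 'h \<times> complex) \<Rightarrow> bool" where
  "elliptic T \<longleftrightarrow> (\<exists>x\<in>ball 0 1. ball_action T x = x)"

definition timelike_eigenspace ::
    "('h::chilbert_space \<times> complex \<Rightarrow> 'h \<times> complex) \<Rightarrow> ('h \<times> complex) set \<Rightarrow> bool" where
  "timelike_eigenspace T M \<longleftrightarrow> (\<exists>c. M = {v. T v = c *\<^sub>C v}) \<and> (\<exists>v\<in>M. timelike v)"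

definition direct_sum :: "'v::ab_group_add set \<Rightarrow> 'v set \<Rightarrow> bool" where
  "direct_sum M N \<longleftrightarrow> M \<inter> N = {0} \<and> (\<forall>v. \<exists>m\<in>M. \<exists>n\<in>N. v = m + n)"

definition op_sum :: "'v::ab_group_add set \<Rightarrow> 'v set \<Rightarrow> ('v \<Rightarrow> 'v) \<Rightarrow> ('v \<Rightarrow> 'v) \<Rightarrow> 'v \<Rightarrow> 'v" where
  "op_sum M N S1 S2 v = (THE w. \<exists>m\<in>M. \<exists>n\<in>N. v = m + n \<and> w = S1 m + S2 n)"

definition form_dist :: "('v::ab_group_add \<Rightarrow> 'v \<Rightarrow> complex) \<Rightarrow> 'v \<Rightarrow> 'v \<Rightarrow> real" where
  "form_dist A x y = sqrt (Re (A (x - y) (x - y)))"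

text \<open>The subspace \<open>N\<close> is a Hilbert space with inner product \<open>A\<close>; completeness refers to
  the norm induced by \<open>A\<close>, not to the ambient topology.\<close>

definition hilbert_space_on :: "'v::complex_vector set \<Rightarrow> ('v \<Rightarrow> 'v \<Rightarrow> complex) \<Rightarrow> bool" where
  "hilbert_space_on N A \<longleftrightarrow>
     cvs.subspace N \<and>
     (\<forall>x\<in>N. \<forall>y\<in>N. A x y = cnj (A y x)) \<and>
     (\<forall>x\<in>N. \<forall>y\<in>N. \<forall>z\<in>N. A (x + y) z = A x z + A y z) \<and>
     (\<forall>a. \<forall>x\<in>N. \<forall>y\<in>N. A (a *\<^sub>C x) y = a * A x y) \<and>
     (\<forall>x\<in>N. x \<noteq> 0 \<longrightarrow> 0 < Re (A x x)) \<and>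
     (\<forall>s::nat \<Rightarrow> 'v. range s \<subseteq> N \<and> (\<forall>e>0. \<exists>K. \<forall>m\<ge>K. \<forall>n\<ge>K. form_dist A (s m) (s n) < e) \<longrightarrow>
        (\<exists>l\<in>N. (\<lambda>n. form_dist A (s n) l) \<longlonglongrightarrow> 0))"

text \<open>Boundedness with respect to the norm induced by \<open>A\<close> follows from preservation of \<open>A\<close>.\<close>

definition unitary_group :: "'v::complex_vector set \<Rightarrow> ('v \<Rightarrow> 'v \<Rightarrow> complex) \<Rightarrow> ('v \<Rightarrow> 'v) monoid" where
  "unitary_group N A =
    \<lparr>carrier = {f \<in> extensional N. bij_betw f N N \<and> clinear_on N f \<and> preserves_on N A f},
     monoid.mult = compose N,
     one = (\<lambda>x\<in>N. x)\<rparr>"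

end

theory Submission
  imports Defs
begin

text \<open>
  A time-like \<open>p \<in> M\<close> makes the form coercive on \<open>dagger {p}\<close>: if \<open>v = (x, w)\<close> is orthogonal
  to \<open>p = (a, z)\<close>, then Cauchy--Schwarz gives \<open>\<bar>w\<bar> \<bar>z\<bar> \<le> \<parallel>x\<parallel> \<parallel>a\<parallel>\<close> with \<open>\<parallel>a\<parallel> < \<bar>z\<bar>\<close>. So there the
  form is an inner product equivalent to the ambient one, and every closed subspace of
  \<open>dagger {p}\<close> is a Hilbert space for it. Splitting off the line through \<open>p\<close> and projecting
  onto \<open>M \<inter> dagger {p}\<close> then decomposes the whole space into \<open>M\<close> and \<open>dagger M\<close>. An isometry that
  commutes with \<open>T\<close> maps the eigenspace \<open>M\<close>, hence also \<open>dagger M\<close>, onto itself; conversely, every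
  isometry of \<open>M\<close> commutes with \<open>T\<close> there, since \<open>T\<close> is a scalar on \<open>M\<close>.
\<close>

section \<open>Hermitian forms and orthogonal projection\<close>

lemma tendsto_zero_norm_power2_le:
  fixes f :: "nat \<Rightarrow> 'a::real_normed_vector"
  assumes "\<And>n. (norm (f n))\<^sup>2 \<le> g n" "g \<longlonglongrightarrow> 0"
  shows "f \<longlonglongrightarrow> 0"
proof -
  have "(\<lambda>n. (norm (f n))\<^sup>2) \<longlonglongrightarrow> 0"
    by (rule Lim_null_comparison[OF _ assms(2)]) (simp add: assms(1))
  then have "(\<lambda>n. sqrt ((norm (f n))\<^sup>2)) \<longlonglongrightarrow> sqrt 0"
    by (rule tendsto_real_sqrt)
  then show ?thesis
    by (simp add: tendsto_norm_zero_iff)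
qed

text \<open>No definiteness is assumed, so that the locale covers both the inner product and the
  indefinite form \<open>hform\<close>.\<close>

locale hermitian_form =
  fixes A :: "'v::complex_vector \<Rightarrow> 'v \<Rightarrow> complex"
  assumes commute: "A x y = cnj (A y x)"
    and add_left: "A (x + y) z = A x z + A y z"
    and scaleC_left: "A (a *\<^sub>C x) y = a * A x y"
begin

lemma add_right: "A x (y + z) = A x y + A x z"
  by (metis add_left commute complex_cnj_add)

lemma scaleC_right: "A x (a *\<^sub>C y) = cnj a * A x y"
  by (metis commute complex_cnj_mult scaleC_left)

lemma minus_left: "A (- x) y = - A x y"
  using scaleC_left[of "-1" x y] by simp

lemma minus_right: "A x (- y) = - A x y"
  using scaleC_right[of x "-1" y] by simp

lemma diff_left: "A (x - y) z = A x z - A y z"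
  using add_left[of x "- y" z] by (simp add: minus_left)

lemma diff_right: "A x (y - z) = A x y - A x z"
  using add_right[of x y "- z"] by (simp add: minus_right)

lemma zero_left [simp]: "A 0 y = 0"
  using diff_left[of 0 0 y] by simp

lemma zero_right [simp]: "A x 0 = 0"
  using diff_right[of x 0 0] by simp

lemmas simps = add_left add_right diff_left diff_right scaleC_left scaleC_right

lemma self_real: "A x x = of_real (Re (A x x))"
  using commute[of x x] by (simp add: complex_eq_iff)

text \<open>For \<open>d = 0\<close> this is the Cauchy--Schwarz inequality; for \<open>d\<close> the squared distance from a
  subspace it shows that minimising sequences become orthogonal to that subspace.\<close>

lemma variational_inequality:
  assumes d: "\<And>t. d \<le> Re (A (x - t *\<^sub>C u) (x - t *\<^sub>C u))"
    and pos: "0 < Re (A u u)"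
  shows "(cmod (A x u))\<^sup>2 \<le> Re (A u u) * (Re (A x x) - d)"
proof -
  define q where "q = Re (A u u)"
  define b where "b = A x u"
  have q: "q > 0" and uu: "A u u = of_real q"
    using pos self_real[of u] by (simp_all add: q_def)
  have ux: "A u x = cnj b"
    unfolding b_def by (rule commute)
  \<comment> \<open>The minimiser of the quadratic in \<open>t\<close>: the coefficient of the
    projection of \<open>x\<close> onto the line of \<open>u\<close>.\<close>
  define t where "t = b / of_real q"
  have "A (x - t *\<^sub>C u) (x - t *\<^sub>C u) = A x x - cnj t * b - t * cnj b + t * cnj t * of_real q"
    by (simp add: simps uu ux algebra_simps flip: b_def)
  also have "\<dots> = A x x - of_real ((cmod b)\<^sup>2 / q)"
  proof -
    have "b * cnj b = of_real ((cmod b)\<^sup>2)"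
      by (rule complex_norm_square[symmetric])
    then show ?thesis
      using q by (simp add: t_def field_simps)
  qed
  finally have "d \<le> Re (A x x) - (cmod b)\<^sup>2 / q"
    using d[of t] by simp
  then show ?thesis
    using q by (simp add: field_simps flip: b_def q_def)
qed

text \<open>The parallelogram law for \<open>v - x\<close> and \<open>v - y\<close>, whose sum is
  twice the difference of \<open>v\<close> and the midpoint of \<open>x\<close> and
  \<open>y\<close>. It makes near-minimisers of the distance to \<open>v\<close> close to each
  other.\<close>

lemma parallelogram: "Re (A (x - y) (x - y)) =
    2 * Re (A (v - x) (v - x)) + 2 * Re (A (v - y) (v - y))
    - 4 * Re (A (v - (1/2) *\<^sub>C (x + y)) (v - (1/2) *\<^sub>C (x + y)))"
proof -
  have "A (x - y) (x - y) = 2 * A (v - x) (v - x) + 2 * A (v - y) (v - y)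
    - 4 * A (v - (1/2) *\<^sub>C (x + y)) (v - (1/2) *\<^sub>C (x + y))"
    by (simp add: simps algebra_simps)
  then show ?thesis
    by simp
qed

text \<open>A minimising sequence for the squared distance from \<open>v\<close> to \<open>L\<close>
  is Cauchy by the parallelogram law, and its limit in \<open>L\<close> is the projection.
  Positivity is asked only on \<open>L\<close> and on the differences \<open>v - l\<close>, since
  the form may be indefinite on the whole space.\<close>

lemma orthogonal_projection_exists:
  assumes L: "hilbert_space_on L A" and vL: "\<And>l. l \<in> L \<Longrightarrow> 0 \<le> Re (A (v - l) (v - l))"
  obtains m where "m \<in> L" "\<And>u. u \<in> L \<Longrightarrow> A (v - m) u = 0"
proof -
  have sub: "cvs.subspace L" and pos: "\<And>x. x \<in> L \<Longrightarrow> x \<noteq> 0 \<Longrightarrow> 0 < Re (A x x)"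
    and complete: "\<And>s::nat \<Rightarrow> 'v. range s \<subseteq> L \<Longrightarrow>
      (\<forall>e>0. \<exists>K. \<forall>m\<ge>K. \<forall>n\<ge>K. form_dist A (s m) (s n) < e) \<Longrightarrow>
        (\<exists>l\<in>L. (\<lambda>n. form_dist A (s n) l) \<longlonglongrightarrow> 0)"
    using L unfolding hilbert_space_on_def by blast+
  have nonneg: "0 \<le> Re (A x x)" if "x \<in> L" for x
    using pos[OF that] by (cases "x = 0") auto
  define d where "d = (INF l\<in>L. Re (A (v - l) (v - l)))"
  have bdd: "bdd_below ((\<lambda>l. Re (A (v - l) (v - l))) ` L)"
    using vL by (auto intro!: bdd_belowI2)
  have ne: "L \<noteq> {}"
    using cvs.subspace_0[OF sub] by auto
  have d: "d \<le> Re (A (v - l) (v - l))" if "l \<in> L" for l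
    unfolding d_def using bdd that by (rule cINF_lower)
  have "\<exists>l\<in>L. Re (A (v - l) (v - l)) < d + 1 / Suc n" for n :: nat
    using cINF_less_iff[OF ne bdd, of "d + 1 / Suc n"] unfolding d_def by simp
  then obtain s where s: "\<And>n. s n \<in> L" "\<And>n. Re (A (v - s n) (v - s n)) < d + 1 / Suc n"
    by metis
  \<comment> \<open>The midpoint lies in \<open>L\<close>, so its squared distance is at least
    \<open>d\<close> and the multiples of \<open>d\<close> cancel in the parallelogram law.\<close>
  have close: "Re (A (s i - s j) (s i - s j)) < 2 / Suc i + 2 / Suc j" for i j
  proof -
    have "(1/2) *\<^sub>C (s i + s j) \<in> L"
      using sub s by (simp add: cvs.subspace_add cvs.subspace_scale)
    from d[OF this] show ?thesis
      unfolding parallelogram[of "s i" "s j" v] using s(2)[of i] s(2)[of j] by simp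
  qed
  have cauchy: "\<exists>K. \<forall>i\<ge>K. \<forall>j\<ge>K. form_dist A (s i) (s j) < e" if e: "e > 0" for e
  proof -
    \<comment> \<open>With this bound \<open>2 / Suc i\<close> and \<open>2 / Suc j\<close> are each
      below \<open>e\<^sup>2 / 2\<close>.\<close>
    obtain K :: nat where K: "inverse (real (Suc K)) < e\<^sup>2 / 4"
      using reals_Archimedean[of "e\<^sup>2 / 4"] e by auto
    have "form_dist A (s i) (s j) < e" if "i \<ge> K" "j \<ge> K" for i j
    proof -
      have "2 / Suc i \<le> 2 * inverse (real (Suc K))" "2 / Suc j \<le> 2 * inverse (real (Suc K))"
        using that by (auto simp: divide_inverse)
      then have "Re (A (s i - s j) (s i - s j)) < e\<^sup>2"
        using close[of i j] K by linarith
      then show ?thesis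
        unfolding form_dist_def using e by (simp add: real_less_lsqrt)
    qed
    then show ?thesis
      by blast
  qed
  obtain m where m: "m \<in> L" "(\<lambda>n. form_dist A (s n) m) \<longlonglongrightarrow> 0"
    using complete[of s] s(1) cauchy by blast
  \<comment> \<open>Split \<open>v - m\<close> as \<open>(v - s n) + (s n - m)\<close>: the first
    term is nearly orthogonal to \<open>u\<close> because \<open>s n\<close> nearly attains the
    infimum \<open>d\<close>, the second because it is small.\<close>
  have "A (v - m) u = 0" if u: "u \<in> L" for u
  proof (cases "u = 0")
    case False
    then have q: "0 < Re (A u u)"
      using pos u by blast
    have "(cmod (A (v - s n) u))\<^sup>2 \<le> Re (A u u) * (1 / Suc n)" for n
    proof -
      have "d \<le> Re (A (v - s n - t *\<^sub>C u) (v - s n - t *\<^sub>C u))" for t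
        using d[of "s n + t *\<^sub>C u"] s(1)[of n] u sub
        by (simp add: cvs.subspace_add cvs.subspace_scale diff_diff_eq)
      from variational_inequality[OF this q]
      have "(cmod (A (v - s n) u))\<^sup>2 \<le> Re (A u u) * (Re (A (v - s n) (v - s n)) - d)" .
      also have "\<dots> \<le> Re (A u u) * (1 / Suc n)"
        using s(2)[of n] q by (intro mult_left_mono) auto
      finally show ?thesis .
    qed
    moreover have "(\<lambda>n. Re (A u u) * (1 / Suc n)) \<longlonglongrightarrow> 0"
      using tendsto_mult_right_zero[OF LIMSEQ_inverse_real_of_nat] by (simp add: field_simps)
    ultimately have lim1: "(\<lambda>n. A (v - s n) u) \<longlonglongrightarrow> 0"
      by (rule tendsto_zero_norm_power2_le)
    \<comment> \<open>Here the variational inequality serves with \<open>d = 0\<close>, as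
      Cauchy-Schwarz on \<open>L\<close>.\<close>
    have "(cmod (A (s n - m) u))\<^sup>2 \<le> Re (A u u) * (form_dist A (s n) m)\<^sup>2" for n
    proof -
      have sm: "s n - m \<in> L"
        using s(1) m(1) sub by (simp add: cvs.subspace_diff)
      then have "0 \<le> Re (A (s n - m - t *\<^sub>C u) (s n - m - t *\<^sub>C u))" for t
        using u sub by (intro nonneg) (simp add: cvs.subspace_diff cvs.subspace_scale)
      from variational_inequality[OF this q] show ?thesis
        using nonneg[OF sm] by (simp add: form_dist_def)
    qed
    moreover have "(\<lambda>n. Re (A u u) * (form_dist A (s n) m)\<^sup>2) \<longlonglongrightarrow> 0"
      using tendsto_mult_right_zero[OF tendsto_null_power[OF m(2), of 2]] by simp
    ultimately have "(\<lambda>n. A (s n - m) u) \<longlonglongrightarrow> 0"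
      by (rule tendsto_zero_norm_power2_le)
    from tendsto_add[OF lim1 this] have "(\<lambda>n. A (v - m) u) \<longlonglongrightarrow> 0"
      by (simp flip: add_left)
    then show ?thesis
      by (simp add: tendsto_const_iff)
  qed simp
  then show thesis
    using that m(1) by blast
qed

end

section \<open>Norm and bounded operators of a complex inner product space\<close>

interpretation cinner: hermitian_form "cinner :: 'a::complex_inner \<Rightarrow> 'a \<Rightarrow> complex"
  by unfold_locales (rule cinner_commute cinner_add_left cinner_scaleC_left)+

lemma norm_power2_cinner: "(norm x)\<^sup>2 = Re (cinner x x)"
  by (simp add: norm_eq_sqrt_cinner cinner_ge_zero)

lemma norm_cinner_le: "cmod (cinner x y) \<le> norm x * norm y"
proof (cases "y = 0")
  case False
  then have "0 < Re (cinner y y)"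
    by (simp flip: norm_power2_cinner)
  from cinner.variational_inequality[OF cinner_ge_zero this, of x]
  have "(cmod (cinner x y))\<^sup>2 \<le> (norm x * norm y)\<^sup>2"
    by (simp add: power_mult_distrib mult.commute flip: norm_power2_cinner)
  then show ?thesis
    by (rule power2_le_imp_le) simp
qed simp

lemma norm_scaleC: "norm (a *\<^sub>C x) = cmod a * norm (x::'a::complex_inner)"
proof -
  have "cinner (a *\<^sub>C x) (a *\<^sub>C x) = (a * cnj a) * cinner x x"
    by (simp add: cinner.simps)
  also have "\<dots> = of_real ((cmod a)\<^sup>2) * of_real ((norm x)\<^sup>2)"
    unfolding norm_power2_cinner[of x] complex_norm_square cinner.self_real[of x, symmetric] ..
  finally have "(norm (a *\<^sub>C x))\<^sup>2 = (cmod a * norm x)\<^sup>2"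
    by (simp add: norm_power2_cinner[of "a *\<^sub>C x"] power_mult_distrib)
  then show ?thesis
    by simp
qed

lemma scaleR_scaleC_commute: "a *\<^sub>C r *\<^sub>R x = r *\<^sub>R a *\<^sub>C (x::'a::complex_vector)"
  by (simp add: scaleR_scaleC scaleC_scaleC mult.commute)

lemma bounded_linear_scaleC: "bounded_linear (\<lambda>x::'a::complex_inner. a *\<^sub>C x)"
  by (rule bounded_linear_intro[where K = "cmod a"])
    (simp_all add: scaleC_add_right scaleR_scaleC_commute norm_scaleC mult.commute)

text \<open>Provides the continuity of \<open>T\<close> behind the closedness of its
  eigenspace.\<close>

lemma bounded_linear_clinear_on:
  assumes "clinear_on UNIV f" "bounded_on UNIV f"
  shows "bounded_linear f"
proof -
  obtain K where "\<And>x. norm (f x) \<le> norm x * K"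
    using assms(2) unfolding bounded_on_def by blast
  then show ?thesis
    using assms(1) unfolding clinear_on_def
    by (intro bounded_linear_intro[where K = K]) (auto simp: scaleR_scaleC)
qed

section \<open>The indefinite form and its coercivity\<close>

interpretation hform: hermitian_form "hform :: 'h::chilbert_space \<times> complex \<Rightarrow> _"
proof
  fix x y z :: "'h \<times> complex" and a :: complex
  show "hform x y = cnj (hform y x)"
    using cinner_commute[of "fst x" "fst y"] by (simp add: hform_def)
  show "hform (x + y) z = hform x z + hform y z"
    by (simp add: hform_def cinner_add_left algebra_simps)
  show "hform (a *\<^sub>C x) y = a * hform x y"
    by (simp add: hform_def scaleC_prod_def scaleC_complex_def cinner_scaleC_left algebra_simps)
qed

text \<open>Flipping the sign of the scalar component of \<open>v\<close> turns the form into the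
  inner product and keeps the norm, so Cauchy-Schwarz applies.\<close>

lemma norm_hform_le: "cmod (hform u v) \<le> norm u * norm v"
proof -
  have "hform u v = cinner u (fst v, - snd v)"
    by (simp add: hform_def cinner_prod_def cinner_complex_def)
  moreover have "norm (fst v, - snd v) = norm v"
    by (simp add: norm_prod_def)
  ultimately show ?thesis
    using norm_cinner_le by metis
qed

lemma bounded_linear_hform_left: "bounded_linear (\<lambda>v. hform v m)"
  by (rule bounded_linear_intro[where K = "norm m"])
    (simp_all add: hform.add_left scaleR_scaleC hform.scaleC_left scaleC_complex_def norm_hform_le)

lemma Re_hform_self: "Re (hform v v) = (norm (fst v))\<^sup>2 - (cmod (snd v))\<^sup>2"
  by (simp add: hform_def norm_power2_cinner flip: complex_norm_square)

lemma hform_coercive: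
  assumes "timelike p"
  obtains \<delta> where "\<delta> > 0" "\<And>v. hform v p = 0 \<Longrightarrow> \<delta> * (norm v)\<^sup>2 \<le> Re (hform v v)"
proof -
  define \<alpha> where "\<alpha> = (norm (fst p))\<^sup>2"
  define \<zeta> where "\<zeta> = (cmod (snd p))\<^sup>2"
  have less: "\<alpha> < \<zeta>" and ge: "0 \<le> \<alpha>"
    using assms by (simp_all add: timelike_def Re_hform_self \<alpha>_def \<zeta>_def)
  show thesis
  proof
    \<comment> \<open>With this constant the coercive estimate is equivalent to the Cauchy-Schwarz
      bound on \<open>snd v\<close> derived below. It is positive because \<open>p\<close> is
      time-like.\<close>
    show "(\<zeta> - \<alpha>) / (\<zeta> + \<alpha>) > 0"
      using less ge by simp
    fix v
    assume "hform v p = 0"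
    then have "cmod (snd v) * cmod (snd p) = cmod (cinner (fst v) (fst p))"
      by (simp add: hform_def norm_mult)
    also have "\<dots> \<le> norm (fst v) * norm (fst p)"
      by (rule norm_cinner_le)
    finally have "(cmod (snd v) * cmod (snd p))\<^sup>2 \<le> (norm (fst v) * norm (fst p))\<^sup>2"
      by (intro power_mono) simp_all
    then have "(cmod (snd v))\<^sup>2 * \<zeta> \<le> (norm (fst v))\<^sup>2 * \<alpha>"
      by (simp add: power_mult_distrib \<alpha>_def \<zeta>_def)
    moreover have "(norm v)\<^sup>2 = (norm (fst v))\<^sup>2 + (cmod (snd v))\<^sup>2"
      by (simp add: norm_prod_def)
    ultimately show "(\<zeta> - \<alpha>) / (\<zeta> + \<alpha>) * (norm v)\<^sup>2 \<le> Re (hform v v)"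
      using less ge by (simp add: Re_hform_self field_simps)
  qed
qed

section \<open>Orthogonal complements and the splitting of the space\<close>

lemma subspace_dagger: "cvs.subspace (dagger M)"
  by (rule cvs.subspaceI) (simp_all add: dagger_def hform.simps)

lemma closed_dagger: "closed (dagger M)"
proof -
  have "dagger M = (\<Inter>m\<in>M. {v. hform v m = 0})"
    by (auto simp: dagger_def)
  moreover have "closed {v. hform v m = 0}" for m :: "'a \<times> complex"
    by (intro closed_Collect_eq linear_continuous_on bounded_linear_hform_left continuous_on_const)
  ultimately show ?thesis
    by auto
qed

text \<open>On \<open>L\<close> the distance \<open>form_dist hform\<close> lies between
  \<open>sqrt \<delta>\<close> times the ambient distance and the ambient distance. Cauchy sequences
  for the form are therefore Cauchy in norm, and closedness keeps their limits in
  \<open>L\<close>.\<close>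

lemma hilbert_space_on_hform:
  fixes p :: "'h::chilbert_space \<times> complex"
  assumes p: "timelike p" and L: "cvs.subspace L" "closed L" "\<And>v. v \<in> L \<Longrightarrow> hform v p = 0"
  shows "hilbert_space_on L hform"
proof -
  obtain \<delta> where \<delta>: "\<delta> > 0" "\<And>v. hform v p = 0 \<Longrightarrow> \<delta> * (norm v)\<^sup>2 \<le> Re (hform v v)"
    using hform_coercive[OF p] by blast
  have pos: "0 < Re (hform x x)" if "x \<in> L" "x \<noteq> 0" for x
    using \<delta>(2)[OF L(3)[OF that(1)]] \<delta>(1) that(2) by (smt (verit) mult_pos_pos zero_less_norm_iff zero_less_power)
  have upper: "form_dist hform x y \<le> norm (x - y)" for x y :: "'h \<times> complex"
    unfolding form_dist_def using norm_hform_le[of "x - y" "x - y"] complex_Re_le_cmod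
    by (intro real_le_lsqrt) (auto simp: power2_eq_square intro: order_trans)
  have lower: "sqrt \<delta> * norm (x - y) \<le> form_dist hform x y" if "x \<in> L" "y \<in> L" for x y
  proof -
    have "sqrt (\<delta> * (norm (x - y))\<^sup>2) \<le> form_dist hform x y"
      unfolding form_dist_def using that L \<delta>(2) by (simp add: cvs.subspace_diff)
    then show ?thesis
      by (simp add: real_sqrt_mult)
  qed
  have "\<exists>l\<in>L. (\<lambda>n. form_dist hform (s n) l) \<longlonglongrightarrow> 0"
    if s: "range s \<subseteq> L"
      and c: "\<forall>e>0. \<exists>K. \<forall>m\<ge>K. \<forall>n\<ge>K. form_dist hform (s m) (s n) < e" for s :: "nat \<Rightarrow> _"
  proof -
    have "Cauchy s"
    proof (rule CauchyI)
      fix e :: real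
      assume "e > 0"
      then have "sqrt \<delta> * e > 0"
        using \<delta>(1) by simp
      then obtain K where K: "\<forall>m\<ge>K. \<forall>n\<ge>K. form_dist hform (s m) (s n) < sqrt \<delta> * e"
        using c by blast
      have "norm (s m - s n) < e" if "m \<ge> K" "n \<ge> K" for m n
      proof -
        have "sqrt \<delta> * norm (s m - s n) < sqrt \<delta> * e"
          using lower[of "s m" "s n"] K s that by (meson le_less_trans range_subsetD)
        then show ?thesis
          using \<delta>(1) by simp
      qed
      then show "\<exists>K. \<forall>m\<ge>K. \<forall>n\<ge>K. norm (s m - s n) < e"
        by blast
    qed
    then obtain l where l: "s \<longlonglongrightarrow> l"
      using Cauchy_convergent convergent_def by blast
    have "l \<in> L"
      using closed_sequentially[OF L(2) _ l] s by blast
    moreover have "(\<lambda>n. form_dist hform (s n) l) \<longlonglongrightarrow> 0"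
    proof (rule Lim_null_comparison)
      have "0 \<le> Re (hform x x)" if "x \<in> L" for x
        using pos[OF that] by (cases "x = 0") auto
      then have "0 \<le> form_dist hform (s n) l" for n
        using s \<open>l \<in> L\<close> L(1) unfolding form_dist_def
        by (metis cvs.subspace_diff range_subsetD real_sqrt_ge_zero)
      then show "\<forall>\<^sub>F n in sequentially. norm (form_dist hform (s n) l) \<le> norm (s n - l)"
        using upper by (intro always_eventually) auto
      show "(\<lambda>n. norm (s n - l)) \<longlonglongrightarrow> 0"
        using l by (simp add: LIM_zero tendsto_norm_zero)
    qed
    ultimately show ?thesis
      by blast
  qed
  then show ?thesis
    unfolding hilbert_space_on_def using L(1) pos hform.commute
    by (auto simp: hform.add_left hform.scaleC_left)
qed

text \<open>The projection lemma does not apply to \<open>M\<close> itself, which contains the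
  negative vector \<open>p\<close>. It is applied to \<open>L\<close>, where the form is positive
  definite, after the component along \<open>p\<close> has been removed.\<close>

lemma direct_sum_dagger:
  assumes M: "cvs.subspace M" "closed M" and p: "p \<in> M" "timelike p"
  shows "direct_sum M (dagger M)"
  unfolding direct_sum_def
proof (intro conjI allI)
  define L where "L = M \<inter> dagger {p}"
  have pp: "hform p p \<noteq> 0"
    using p(2) by (auto simp: timelike_def)
  have P: "hilbert_space_on (dagger {p}) hform"
    by (rule hilbert_space_on_hform[OF p(2) subspace_dagger closed_dagger]) (simp add: dagger_def)
  then have pos: "0 < Re (hform x x)" if "x \<in> dagger {p}" "x \<noteq> 0" for x
    using that unfolding hilbert_space_on_def by blast
  have nonneg: "0 \<le> Re (hform x x)" if "hform x p = 0" for x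
    using pos[of x] that by (cases "x = 0") (auto simp: dagger_def)
  have L: "hilbert_space_on L hform"
    unfolding L_def using M
    by (intro hilbert_space_on_hform[OF p(2)] cvs.subspace_inter subspace_dagger closed_Int closed_dagger)
      (auto simp: dagger_def)
  show "M \<inter> dagger M = {0}"
  proof (intro equalityI subsetI)
    fix v
    assume v: "v \<in> M \<inter> dagger M"
    \<comment> \<open>A vector of the intersection is orthogonal to itself and to \<open>p\<close>,
      and the form is definite on \<open>dagger {p}\<close>.\<close>
    then have "hform v v = 0" "v \<in> dagger {p}"
      using p(1) by (auto simp: dagger_def)
    then show "v \<in> {0}"
      using pos[of v] by (cases "v = 0") auto
  qed (simp add: cvs.subspace_0 M(1) subspace_dagger)
  fix v
  \<comment> \<open>Removing the component along \<open>p\<close> puts every \<open>v' - l\<close>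
    with \<open>l\<close> in \<open>L\<close> into \<open>dagger {p}\<close>, where the form is
    nonnegative.\<close>
  define v' where "v' = v - (hform v p / hform p p) *\<^sub>C p"
  have v': "hform v' p = 0"
    using pp by (simp add: v'_def hform.simps)
  obtain m where m: "m \<in> L" "\<And>u. u \<in> L \<Longrightarrow> hform (v' - m) u = 0"
  proof (rule hform.orthogonal_projection_exists[OF L])
    show "0 \<le> Re (hform (v' - l) (v' - l))" if "l \<in> L" for l
      using that v' by (intro nonneg) (simp add: L_def dagger_def hform.simps)
  qed blast
  have mp: "m \<in> M" "hform m p = 0"
    using m(1) by (auto simp: L_def dagger_def)
  have "hform (v' - m) u = 0" if u: "u \<in> M" for u
  proof -
    \<comment> \<open>\<open>M\<close> is spanned by \<open>p\<close> and \<open>L\<close>, so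
      orthogonality to both gives orthogonality to \<open>M\<close>; \<open>a\<close> is the
      coefficient of \<open>u\<close> along \<open>p\<close>.\<close>
    define a where "a = hform u p / hform p p"
    have "u - a *\<^sub>C p \<in> L"
      using u p(1) M(1) pp
      by (simp add: L_def dagger_def a_def hform.simps cvs.subspace_diff cvs.subspace_scale)
    then have "hform (v' - m) (u - a *\<^sub>C p) = 0"
      by (rule m(2))
    then show ?thesis
      using v' mp(2) by (simp add: hform.simps)
  qed
  then have "v' - m \<in> dagger M"
    by (simp add: dagger_def)
  moreover have "m + (hform v p / hform p p) *\<^sub>C p \<in> M"
    using mp(1) p(1) M(1) by (simp add: cvs.subspace_add cvs.subspace_scale)
  moreover have "v = (m + (hform v p / hform p p) *\<^sub>C p) + (v' - m)"
    by (simp add: v'_def)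
  ultimately show "\<exists>m\<in>M. \<exists>n\<in>dagger M. v = m + n"
    by blast
qed

section \<open>Sums of operators over a direct sum\<close>

lemma direct_sum_unique:
  assumes "direct_sum M N" "cvs.subspace M" "cvs.subspace N"
    and "m \<in> M" "n \<in> N" "m' \<in> M" "n' \<in> N" "m + n = m' + n'"
  shows "m = m'" "n = n'"
proof -
  have "m - m' = n' - n"
    using assms(8) by (simp add: algebra_simps)
  then have "m - m' \<in> M \<inter> N"
    using assms by (metis IntI cvs.subspace_diff)
  then show "m = m'"
    using assms(1) unfolding direct_sum_def by (metis eq_iff_diff_eq_0 singletonD)
  then show "n = n'"
    using assms(8) by simp
qed

text \<open>Replaces the definite description in \<open>op_sum\<close>; all later reasoning about it
  goes through this equation.\<close>

lemma op_sum_add: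
  assumes "direct_sum M N" "cvs.subspace M" "cvs.subspace N" "m \<in> M" "n \<in> N"
  shows "op_sum M N S1 S2 (m + n) = S1 m + S2 n"
  unfolding op_sum_def
proof (rule the_equality)
  show "\<exists>m'\<in>M. \<exists>n'\<in>N. m + n = m' + n' \<and> S1 m + S2 n = S1 m' + S2 n'"
    using assms by blast
  show "w = S1 m + S2 n" if "\<exists>m'\<in>M. \<exists>n'\<in>N. m + n = m' + n' \<and> w = S1 m' + S2 n'" for w
    using that direct_sum_unique[OF assms(1-3) assms(4,5)] by metis
qed

section \<open>Isometries, invariant subspaces and blocks\<close>

lemma carrier_isom_group:
  "f \<in> carrier (isom_group N) \<longleftrightarrow> f \<in> extensional N \<and> bij_betw f N N \<and> clinear_on N f \<and>
    bounded_on N f \<and> preserves_on N hform f"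
  by (simp add: isom_group_def)

lemma isom_group_UNIV_D:
  assumes "S \<in> carrier (isom_group UNIV)"
  shows "bij S" "S (x + y) = S x + S y" "S (a *\<^sub>C x) = a *\<^sub>C S x" "hform (S x) (S y) = hform x y"
    "bounded_linear S"
proof -
  have S: "bij S" "clinear_on UNIV S" "bounded_on UNIV S" "preserves_on UNIV hform S"
    using assms unfolding carrier_isom_group by blast+
  then show "bij S" "S (x + y) = S x + S y" "S (a *\<^sub>C x) = a *\<^sub>C S x" "hform (S x) (S y) = hform x y"
    unfolding clinear_on_def preserves_on_def by blast+
  show "bounded_linear S"
    using S(2,3) by (rule bounded_linear_clinear_on)
qed

text \<open>The image has to be all of \<open>N\<close>: in infinite dimension an isometry may map a
  subspace properly into itself, and its restriction would not be onto.\<close>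

lemma restrict_isom_group:
  assumes "S \<in> carrier (isom_group UNIV)" "cvs.subspace N" "S ` N = N"
  shows "restrict S N \<in> carrier (isom_group N)"
proof -
  have "bij_betw S N N"
    by (rule bij_betw_subset[OF isom_group_UNIV_D(1)[OF assms(1)] subset_UNIV assms(3)])
  moreover have "bounded_on N S"
    using assms(1) unfolding carrier_isom_group bounded_on_def by blast
  ultimately show ?thesis
    using isom_group_UNIV_D(2-4)[OF assms(1)] assms(2) unfolding carrier_isom_group
    by (auto simp: clinear_on_def bounded_on_def preserves_on_def cvs.subspace_add
        cvs.subspace_scale cong: bij_betw_cong)
qed

text \<open>Every element of \<open>M\<close> is the image of one in \<open>M\<close>, so
  \<open>S\<close> preserves orthogonality to \<open>M\<close> in both directions; surjectivity
  turns this equivalence into equality with the image.\<close>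

lemma isom_image_dagger:
  assumes S: "S \<in> carrier (isom_group UNIV)" and M: "S ` M = M"
  shows "S ` dagger M = dagger M"
proof -
  have iff: "S v \<in> dagger M \<longleftrightarrow> v \<in> dagger M" for v
  proof -
    have "S v \<in> dagger M \<longleftrightarrow> (\<forall>m\<in>M. hform (S v) (S m) = 0)"
      unfolding dagger_def mem_Collect_eq by (subst (1) M[symmetric]) simp
    then show ?thesis
      by (simp add: isom_group_UNIV_D(4)[OF S] dagger_def)
  qed
  then have "S -` dagger M = dagger M"
    by blast
  then show ?thesis
    using surj_image_vimage_eq[OF bij_is_surj[OF isom_group_UNIV_D(1)[OF S]], of "dagger M"] by simp
qed

text \<open>Commutation and the injectivity of \<open>S\<close> make \<open>S v\<close> an element
  of the eigenspace exactly when \<open>v\<close> is one; surjectivity then gives equality and not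
  only inclusion.\<close>

lemma commuting_isom_image_eigenspace:
  assumes S: "S \<in> carrier (isom_group UNIV)" and comm: "\<And>v. S (T v) = T (S v)"
  shows "S ` {v. T v = c *\<^sub>C v} = {v. T v = c *\<^sub>C v}"
proof -
  have "T (S v) = c *\<^sub>C S v \<longleftrightarrow> T v = c *\<^sub>C v" for v
    using isom_group_UNIV_D(3)[OF S, of c v] bij_is_inj[OF isom_group_UNIV_D(1)[OF S]]
    by (metis comm injD)
  then have "S -` {v. T v = c *\<^sub>C v} = {v. T v = c *\<^sub>C v}"
    by auto
  then show ?thesis
    using surj_image_vimage_eq[OF bij_is_surj[OF isom_group_UNIV_D(1)[OF S]], of "{v. T v = c *\<^sub>C v}"]
    by simp
qed

text \<open>Both products are \<open>undefined\<close> outside \<open>N\<close>, so commuting in the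
  group is decided on \<open>N\<close>.\<close>

lemma centralizer_isom_group:
  assumes "T \<in> carrier (isom_group N)"
  shows "S \<in> centralizer (isom_group N) T \<longleftrightarrow>
    S \<in> carrier (isom_group N) \<and> (\<forall>x\<in>N. S (T x) = T (S x))"
proof -
  have "compose N S T = compose N T S \<longleftrightarrow> (\<forall>x\<in>N. S (T x) = T (S x))"
  proof
    assume eq: "compose N S T = compose N T S"
    show "\<forall>x\<in>N. S (T x) = T (S x)"
    proof
      show "S (T x) = T (S x)" if "x \<in> N" for x
        using fun_cong[OF eq, of x] that by (simp add: compose_eq)
    qed
  next
    show "compose N S T = compose N T S" if "\<forall>x\<in>N. S (T x) = T (S x)"
      unfolding compose_def using that by (intro restrict_ext) blast
  qed
  then show ?thesis
    by (simp add: centralizer_def isom_group_def)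
qed

text \<open>Bijectivity and linearity are inherited from the summands, and the form is preserved
  because the cross terms vanish before and after. Boundedness needs bounded projections onto both
  summands; coercivity on \<open>dagger {p}\<close>, which contains \<open>dagger M\<close>,
  supplies them.\<close>

lemma op_sum_isom_group:
  fixes p :: "'h::chilbert_space \<times> complex"
  assumes M: "cvs.subspace M" "closed M" and p: "p \<in> M" "timelike p"
    and S1: "S1 \<in> carrier (isom_group M)" and S2: "S2 \<in> carrier (isom_group (dagger M))"
  shows "op_sum M (dagger M) S1 S2 \<in> carrier (isom_group UNIV)"
proof -
  define S where "S = op_sum M (dagger M) S1 S2"
  have ds: "direct_sum M (dagger M)"
    by (rule direct_sum_dagger[OF M p])
  note sub = M(1) subspace_dagger[of M]
  have dec: "\<exists>m\<in>M. \<exists>n\<in>dagger M. v = m + n" for v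
    using ds unfolding direct_sum_def by blast
  have S: "S (m + n) = S1 m + S2 n" if "m \<in> M" "n \<in> dagger M" for m n
    unfolding S_def using op_sum_add[OF ds sub that] .
  have img: "S1 ` M = M" "S2 ` dagger M = dagger M" and inj: "inj_on S1 M" "inj_on S2 (dagger M)"
    using S1 S2 by (auto simp: carrier_isom_group bij_betw_def)
  have in1: "S1 m \<in> M" if "m \<in> M" for m
    using img that by blast
  have in2: "S2 n \<in> dagger M" if "n \<in> dagger M" for n
    using img that by blast
  have lin: "clinear_on M S1" "clinear_on (dagger M) S2"
    and pres: "preserves_on M hform S1" "preserves_on (dagger M) hform S2"
    using S1 S2 by (auto simp: carrier_isom_group)
  have orth: "hform m n = 0" "hform n m = 0" if "m \<in> M" "n \<in> dagger M" for m n
    using that hform.commute[of m n] by (auto simp: dagger_def)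
  have "S x = S y \<Longrightarrow> x = y" for x y
  proof -
    assume eq: "S x = S y"
    obtain m n m' n' where d: "m \<in> M" "n \<in> dagger M" "x = m + n" "m' \<in> M" "n' \<in> dagger M" "y = m' + n'"
      using dec[of x] dec[of y] by blast
    then have "S1 m + S2 n = S1 m' + S2 n'"
      using eq S by simp
    then have "S1 m = S1 m'" "S2 n = S2 n'"
      using direct_sum_unique[OF ds sub, of "S1 m" "S2 n" "S1 m'" "S2 n'"] in1 in2 d by simp_all
    then show "x = y"
      using inj d by (metis inj_onD)
  qed
  moreover have "\<exists>x. y = S x" for y
  proof -
    obtain m n where "m \<in> M" "n \<in> dagger M" "y = m + n"
      using dec by blast
    moreover then obtain m' n' where "m' \<in> M" "n' \<in> dagger M" "m = S1 m'" "n = S2 n'"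
      using img by (metis imageE)
    ultimately show ?thesis
      using S by metis
  qed
  ultimately have "bij S"
    unfolding bij_def inj_def surj_def by blast
  moreover have "clinear_on UNIV S"
    unfolding clinear_on_def
  proof (intro conjI ballI allI)
    fix x y :: "'h \<times> complex" and a :: complex
    obtain m n m' n' where d: "m \<in> M" "n \<in> dagger M" "x = m + n" "m' \<in> M" "n' \<in> dagger M" "y = m' + n'"
      using dec[of x] dec[of y] by blast
    have "S ((m + m') + (n + n')) = S1 (m + m') + S2 (n + n')"
      using d sub by (intro S) (simp_all add: cvs.subspace_add)
    then show "S (x + y) = S x + S y"
      using d S lin by (simp add: clinear_on_def algebra_simps)
    have "S (a *\<^sub>C m + a *\<^sub>C n) = S1 (a *\<^sub>C m) + S2 (a *\<^sub>C n)"
      using d sub by (intro S) (simp_all add: cvs.subspace_scale)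
    then show "S (a *\<^sub>C x) = a *\<^sub>C S x"
      using d S lin by (simp add: clinear_on_def scaleC_add_right)
  qed
  moreover have "preserves_on UNIV hform S"
    unfolding preserves_on_def
  proof (intro ballI)
    fix x y :: "'h \<times> complex"
    obtain m n m' n' where d: "m \<in> M" "n \<in> dagger M" "x = m + n" "m' \<in> M" "n' \<in> dagger M" "y = m' + n'"
      using dec[of x] dec[of y] by blast
    then show "hform (S x) (S y) = hform x y"
      using pres by (simp add: S hform.add_left hform.add_right orth in1 in2 preserves_on_def)
  qed
  moreover have "bounded_on UNIV S"
  proof -
    obtain \<delta> where \<delta>: "\<delta> > 0" "\<And>v. hform v p = 0 \<Longrightarrow> \<delta> * (norm v)\<^sup>2 \<le> Re (hform v v)"
      using hform_coercive[OF p(2)] by blast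
    obtain K1 K2 where K: "\<And>m. m \<in> M \<Longrightarrow> norm (S1 m) \<le> norm m * K1"
      "\<And>n. n \<in> dagger M \<Longrightarrow> norm (S2 n) \<le> norm n * K2"
      using S1 S2 unfolding carrier_isom_group bounded_on_def by blast
    \<comment> \<open>\<open>1 / \<delta>\<close> bounds the projection onto \<open>dagger M\<close>
      and \<open>1 + 1 / \<delta>\<close> the one onto \<open>M\<close>. The absolute values guard
      against negative \<open>K1\<close> and \<open>K2\<close>.\<close>
    have "norm (S x) \<le> norm x * ((1 + 1 / \<delta>) * \<bar>K1\<bar> + 1 / \<delta> * \<bar>K2\<bar>)" for x
    proof -
      obtain m n where d: "m \<in> M" "n \<in> dagger M" "x = m + n"
        using dec[of x] by blast
      \<comment> \<open>The projection onto \<open>dagger M\<close> is bounded because \<open>hform n n = hform x n\<close>.\<close>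
      have "\<delta> * (norm n)\<^sup>2 \<le> Re (hform n n)"
        using \<delta>(2) d p(1) by (simp add: dagger_def)
      also have "hform n n = hform x n"
        using d by (simp add: hform.add_left orth)
      also have "Re (hform x n) \<le> norm x * norm n"
        using norm_hform_le complex_Re_le_cmod order_trans by blast
      finally have "norm n * (\<delta> * norm n) \<le> norm n * norm x"
        by (simp add: power2_eq_square mult_ac)
      then have "\<delta> * norm n \<le> norm x"
        by (cases "n = 0") auto
      then have n: "norm n \<le> norm x * (1 / \<delta>)"
        using \<delta>(1) by (simp add: field_simps)
      have "norm m \<le> norm x + norm n"
        using d(3) norm_triangle_ineq4[of x n] by simp
      then have m: "norm m \<le> norm x * (1 + 1 / \<delta>)"
        using n by (simp add: distrib_left)
      have "norm (S x) \<le> norm (S1 m) + norm (S2 n)"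
        using d S norm_triangle_ineq by simp
      also have "\<dots> \<le> norm m * \<bar>K1\<bar> + norm n * \<bar>K2\<bar>"
        using K(1)[OF d(1)] K(2)[OF d(2)]
        by (intro add_mono) (meson abs_ge_self mult_left_mono norm_ge_zero order_trans)+
      also have "\<dots> \<le> norm x * (1 + 1 / \<delta>) * \<bar>K1\<bar> + norm x * (1 / \<delta>) * \<bar>K2\<bar>"
        using m n by (intro add_mono mult_right_mono) auto
      finally show ?thesis
        by (simp add: algebra_simps)
    qed
    then show ?thesis
      unfolding bounded_on_def by blast
  qed
  ultimately show ?thesis
    by (simp add: carrier_isom_group flip: S_def)
qed

section \<open>The centralizer of an elliptic isometry\<close>

theorem theorem1p5:
  fixes T :: "'h::chilbert_space \<times> complex \<Rightarrow> 'h \<times> complex"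
    and M :: "('h \<times> complex) set"
  assumes "T \<in> carrier (isom_group UNIV)"
    and "elliptic T"
    and "timelike_eigenspace T M"
  shows "direct_sum M (dagger M) \<and>
    hilbert_space_on (dagger M) hform \<and>
    restrict T (dagger M) \<in> carrier (isom_group (dagger M)) \<and>
    centralizer (isom_group UNIV) T =
      {op_sum M (dagger M) S1 S2 | S1 S2.
         S1 \<in> carrier (isom_group M) \<and>
         S2 \<in> centralizer (isom_group (dagger M)) (restrict T (dagger M))} \<and>
    centralizer (isom_group (dagger M)) (restrict T (dagger M))
      \<subseteq> carrier (unitary_group (dagger M) hform)"
proof -
  note T = isom_group_UNIV_D[OF assms(1)]
  obtain c p where Mc: "M = {v. T v = c *\<^sub>C v}" and p: "p \<in> M" "timelike p"
    using assms(3) unfolding timelike_eigenspace_def by blast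
  have sub: "cvs.subspace M"
    unfolding Mc using T(3)[of 0]
    by (intro cvs.subspaceI) (auto simp: T scaleC_add_right scaleC_scaleC mult.commute)
  have closed: "closed M"
    unfolding Mc by (intro closed_Collect_eq linear_continuous_on T(5) bounded_linear_scaleC)
  have ds: "direct_sum M (dagger M)"
    by (rule direct_sum_dagger[OF sub closed p])
  have dec: "\<exists>m\<in>M. \<exists>n\<in>dagger M. v = m + n" for v
    using ds unfolding direct_sum_def by blast
  note op = op_sum_add[OF ds sub subspace_dagger]
  have hilbert: "hilbert_space_on (dagger M) hform"
    using p(1) by (intro hilbert_space_on_hform[OF p(2) subspace_dagger closed_dagger])
      (simp add: dagger_def)
  have imgM: "S ` M = M" and imgD: "S ` dagger M = dagger M"
    if "S \<in> centralizer (isom_group UNIV) T" for S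
  proof -
    from that show "S ` M = M"
      unfolding Mc centralizer_isom_group[OF assms(1)]
      by (intro commuting_isom_image_eigenspace) auto
    then show "S ` dagger M = dagger M"
      using that unfolding centralizer_isom_group[OF assms(1)] by (intro isom_image_dagger) auto
  qed
  \<comment> \<open>\<open>T\<close> lies in its own centralizer, so the invariance just shown
    applies to it.\<close>
  have TD: "T ` dagger M = dagger M"
    using assms(1) by (intro imgD) (simp add: centralizer_isom_group)
  then have rT: "restrict T (dagger M) \<in> carrier (isom_group (dagger M))"
    by (rule restrict_isom_group[OF assms(1) subspace_dagger])
  \<comment> \<open>Inclusion from left to right: the blocks are the restrictions of
    \<open>S\<close> to the two invariant summands.\<close>
  have "\<exists>S1 S2. S = op_sum M (dagger M) S1 S2 \<and> S1 \<in> carrier (isom_group M) \<and>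
      S2 \<in> centralizer (isom_group (dagger M)) (restrict T (dagger M))"
    if S: "S \<in> centralizer (isom_group UNIV) T" for S
  proof (intro exI conjI)
    have SG: "S \<in> carrier (isom_group UNIV)" and comm: "\<And>v. S (T v) = T (S v)"
      using S unfolding centralizer_isom_group[OF assms(1)] by blast+
    show "S = op_sum M (dagger M) (restrict S M) (restrict S (dagger M))"
    proof
      fix v
      obtain m n where "m \<in> M" "n \<in> dagger M" "v = m + n"
        using dec by blast
      then show "S v = op_sum M (dagger M) (restrict S M) (restrict S (dagger M)) v"
        by (simp add: op isom_group_UNIV_D(2)[OF SG])
    qed
    show "restrict S M \<in> carrier (isom_group M)"
      by (rule restrict_isom_group[OF SG sub imgM[OF S]])
    show "restrict S (dagger M) \<in> centralizer (isom_group (dagger M)) (restrict T (dagger M))"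
      unfolding centralizer_isom_group[OF rT]
      using restrict_isom_group[OF SG subspace_dagger imgD[OF S]] TD imgD[OF S] comm
      by (auto simp: restrict_def)
  qed
  \<comment> \<open>Converse inclusion: as \<open>T\<close> is additive and preserves both summands,
    commutation can be checked on each of them.\<close>
  moreover have "op_sum M (dagger M) S1 S2 \<in> centralizer (isom_group UNIV) T"
    if S1: "S1 \<in> carrier (isom_group M)"
      and S2: "S2 \<in> centralizer (isom_group (dagger M)) (restrict T (dagger M))" for S1 S2
    unfolding centralizer_isom_group[OF assms(1)]
  proof (intro conjI ballI)
    have S2G: "S2 \<in> carrier (isom_group (dagger M))"
      and comm: "\<And>x. x \<in> dagger M \<Longrightarrow> S2 (restrict T (dagger M) x) = restrict T (dagger M) (S2 x)"
      using S2 by (simp_all add: centralizer_isom_group[OF rT])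
    show "op_sum M (dagger M) S1 S2 \<in> carrier (isom_group UNIV)"
      by (rule op_sum_isom_group[OF sub closed p S1 S2G])
    fix v
    obtain m n where d: "m \<in> M" "n \<in> dagger M" "v = m + n"
      using dec by blast
    have "S1 m \<in> M" "S2 n \<in> dagger M"
      using d S1 S2G by (auto simp: carrier_isom_group bij_betw_def)
    moreover have "T m \<in> M" "T n \<in> dagger M"
      using d TD sub by (auto simp: Mc cvs.subspace_scale T)
    \<comment> \<open>On \<open>M\<close> the operator \<open>T\<close> is multiplication by
      \<open>c\<close>, so this is homogeneity of \<open>S1\<close>.\<close>
    moreover have "S1 (T m) = T (S1 m)"
    proof -
      have "S1 (c *\<^sub>C m) = c *\<^sub>C S1 m"
        using d(1) S1 unfolding carrier_isom_group clinear_on_def by blast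
      then show ?thesis
        using d(1) \<open>S1 m \<in> M\<close> by (simp add: Mc)
    qed
    moreover have "S2 (T n) = T (S2 n)"
      using comm[OF d(2)] d(2) \<open>S2 n \<in> dagger M\<close> by simp
    ultimately show "op_sum M (dagger M) S1 S2 (T v) = T (op_sum M (dagger M) S1 S2 v)"
      using d by (simp add: op T(2))
  qed
  ultimately have "centralizer (isom_group UNIV) T = {op_sum M (dagger M) S1 S2 | S1 S2.
      S1 \<in> carrier (isom_group M) \<and>
      S2 \<in> centralizer (isom_group (dagger M)) (restrict T (dagger M))}"
    by blast
  \<comment> \<open>The two carriers differ by the boundedness clause of \<open>isom_group\<close>,
    which makes the inclusion immediate; that the form is a Hilbert space inner product here is the
    content of \<open>hilbert\<close>.\<close>
  moreover have "centralizer (isom_group (dagger M)) (restrict T (dagger M))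
      \<subseteq> carrier (unitary_group (dagger M) hform)"
    by (auto simp: centralizer_def isom_group_def unitary_group_def)
  ultimately show ?thesis
    using ds hilbert rT by blast
qed

end
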